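(* Let $(P,\leq)$ be a down-directed poset, $*$ a binary operation on $P$, $1\in P$, and $(P,\sqcap)$ a commutative meet-directoid assigned to $(P,\leq)$. Then $(P,\leq,*,1)$ is a relatively pseudocomplemented poset if and only if $(P,\sqcap,*,1)$ satisfies the following conditions: (i) for all $x\in P$: $x\sqcap 1=x$; (ii) for all $x,y,z\in P$: $\Big((x\sqcap z)\sqcap\big((x*y)\sqcap z\big)\Big)\sqcap y=(x\sqcap z)\sqcap\big((x*y)\sqcap z\big)$; (iii) for all $x,y,z\in P$: if $\big((x\sqcap t)\sqcap(z\sqcap t)\big)\sqcap y=(x\sqcap t)\sqcap(z\sqcap t)$ for all $t\in P$, then $z\sqcap(x*y)=z$.
   Context: For a poset $(P,\leq)$ and $x,y\in P$ let $L(x)=\{z\in P\mid z\leq x\}$ and $L(x,y)=\{z\in P\mid z\leq x\text{ and }z\leq y\}$. The poset is down-directed if $L(x,y)\neq\emptyset$ for all $x,y\in P$. A commutative meet-directoid assigned to a down-directed poset $(P,\leq)$ is a groupoid $(P,\sqcap)$ such that for all $x,y\in P$: $x\sqcap y=y\sqcap x\in L(x,y)$, and $x\sqcap y=\min(x,y)$ whenever $x$ and $y$ are comparable (for incomparable $x,y$ the element $x\sqcap y=y\sqcap x$ is an arbitrarily chosen element of $L(x,y)$). A relatively pseudocomplemented poset is a quadruple $(P,\leq,*,1)$ such that $(P,\leq)$ is a poset, $*$ is a binary operation on $P$ such that for all $x,y\in P$, $x*y$ is the greatest element $z$ of $P$ satisfying $L(x,z)\subseteq L(y)$, and $1$ is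 the top element of $(P,\leq)$. *)

theory Defs
  imports Main
begin

definition lower_cone :: "'a::order \<Rightarrow> 'a set"
  where "lower_cone x = {z. z \<le> x}"

definition lower_cone2 :: "'a::order \<Rightarrow> 'a \<Rightarrow> 'a set"
  where "lower_cone2 x y = {z. z \<le> x \<and> z \<le> y}"

(* The poset is the carrier of the type 'a with its class order, so this is a
   property of the type alone; the itself argument selects the type. *)
definition down_directed :: "'a::order itself \<Rightarrow> bool"
  where "down_directed _ \<longleftrightarrow> (\<forall>x y :: 'a. lower_cone2 x y \<noteq> {})"

(* min x y is only used for comparable x and y: the order of 'a need not be linear. *)
definition commutative_meet_directoid :: "('a::order \<Rightarrow> 'a \<Rightarrow> 'a) \<Rightarrow> bool"
  where "commutative_meet_directoid m \<longleftrightarrow>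
    (\<forall>x y. m x y = m y x \<and> m x y \<in> lower_cone2 x y \<and>
       (x \<le> y \<or> y \<le> x \<longrightarrow> m x y = min x y))"

definition is_greatest_in :: "'a::order \<Rightarrow> 'a set \<Rightarrow> bool"
  where "is_greatest_in g A \<longleftrightarrow> g \<in> A \<and> (\<forall>z\<in>A. z \<le> g)"

definition relatively_pseudocomplemented :: "('a::order \<Rightarrow> 'a \<Rightarrow> 'a) \<Rightarrow> 'a \<Rightarrow> bool"
  where "relatively_pseudocomplemented r e \<longleftrightarrow>
    (\<forall>x y. is_greatest_in (r x y) {z. lower_cone2 x z \<subseteq> lower_cone y}) \<and>
    is_greatest_in e UNIV"

end

theory Submission
  imports Defs
begin

text \<open>
  A commutative meet-directoid encodes its order, because \<open>x \<sqinter> y = x\<close> holds exactly if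
  \<open>x \<le> y\<close>. Every identity in the theorem has this shape, so each one is an inequality in
  disguise, and (i) says that \<open>e\<close> is the top element.

  The operation is not a meet, and a single element \<open>x \<sqinter> z\<close> does not describe the lower cone
  \<open>L(x, z)\<close>. The terms \<open>(x \<sqinter> t) \<sqinter> (z \<sqinter> t)\<close> together do: each of them lies in
  \<open>L(x, z)\<close>, and a member \<open>t\<close> of \<open>L(x, z)\<close> is itself the value of the term at \<open>t\<close>
  (lemma \<open>range_meet_term\<close>). An inclusion \<open>L(x, z) \<subseteq> L(y)\<close> can therefore be written with a
  universally quantified \<open>t\<close> (lemma \<open>cone_subset_iff\<close>). Under this translation (ii) says that
  \<open>x \<star> y\<close> is one of the elements \<open>z\<close> with \<open>L(x, z) \<subseteq> L(y)\<close>, and (iii) says that it is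
  above all of them.
\<close>

lemma meet_eq_left_iff:
  assumes "commutative_meet_directoid m"
  shows "m x y = x \<longleftrightarrow> x \<le> y"
proof
  assume "m x y = x"
  moreover have "m x y \<in> lower_cone2 x y"
    using assms by (simp add: commutative_meet_directoid_def)
  ultimately show "x \<le> y"
    by (simp add: lower_cone2_def)
next
  assume "x \<le> y"
  then show "m x y = x"
    using assms by (simp add: commutative_meet_directoid_def min_def)
qed

text \<open>
  Meeting both arguments with \<open>t\<close> before meeting them with each other lets \<open>t\<close> select any
  prescribed element of the cone, since a meet of comparable elements is their minimum.
\<close>

lemma range_meet_term:
  assumes "commutative_meet_directoid m"
  shows "range (\<lambda>t. m (m x t) (m z t)) = lower_cone2 x z"
proof
  have lower: "m u v \<le> u \<and> m u v \<le> v" for u v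
    using assms by (simp add: commutative_meet_directoid_def lower_cone2_def)
  show "range (\<lambda>t. m (m x t) (m z t)) \<subseteq> lower_cone2 x z"
    unfolding lower_cone2_def using lower by (blast intro: order_trans)
next
  show "lower_cone2 x z \<subseteq> range (\<lambda>t. m (m x t) (m z t))"
  proof
    fix t
    assume "t \<in> lower_cone2 x z"
    then have "m t x = t" and "m t z = t"
      using meet_eq_left_iff[OF assms] by (simp_all add: lower_cone2_def)
    moreover have "m x t = m t x" and "m z t = m t z"
      using assms by (simp_all add: commutative_meet_directoid_def)
    moreover have "m t t = t"
      using meet_eq_left_iff[OF assms] by simp
    ultimately have "t = m (m x t) (m z t)"
      by simp
    then show "t \<in> range (\<lambda>t. m (m x t) (m z t))"
      by (rule range_eqI)
  qed
qed

lemma cone_subset_iff: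
  assumes "commutative_meet_directoid m"
  shows "lower_cone2 x z \<subseteq> lower_cone y \<longleftrightarrow>
    (\<forall>t. m (m (m x t) (m z t)) y = m (m x t) (m z t))"
  unfolding range_meet_term[OF assms, symmetric] meet_eq_left_iff[OF assms]
  by (auto simp: lower_cone_def)

theorem theorem4p3:
  fixes meet :: "'a::order \<Rightarrow> 'a \<Rightarrow> 'a" (infixl "\<sqinter>" 70)
    and rpc :: "'a \<Rightarrow> 'a \<Rightarrow> 'a" (infixl "\<star>" 75)
    and e :: 'a
  assumes "down_directed TYPE('a)"
    and "commutative_meet_directoid (\<sqinter>)"
  shows "relatively_pseudocomplemented (\<star>) e \<longleftrightarrow>
    (\<forall>x. x \<sqinter> e = x) \<and>
    (\<forall>x y z. ((x \<sqinter> z) \<sqinter> ((x \<star> y) \<sqinter> z)) \<sqinter> y = (x \<sqinter> z) \<sqinter> ((x \<star> y) \<sqinter> z)) \<and>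
    (\<forall>x y z. (\<forall>t. ((x \<sqinter> t) \<sqinter> (z \<sqinter> t)) \<sqinter> y = (x \<sqinter> t) \<sqinter> (z \<sqinter> t)) \<longrightarrow>
       z \<sqinter> (x \<star> y) = z)"
proof -
  have top: "is_greatest_in e UNIV \<longleftrightarrow> (\<forall>x. x \<sqinter> e = x)"
    by (simp add: is_greatest_in_def meet_eq_left_iff[OF assms(2)])
  have greatest: "is_greatest_in (x \<star> y) {z. lower_cone2 x z \<subseteq> lower_cone y} \<longleftrightarrow>
      (\<forall>z. ((x \<sqinter> z) \<sqinter> ((x \<star> y) \<sqinter> z)) \<sqinter> y = (x \<sqinter> z) \<sqinter> ((x \<star> y) \<sqinter> z)) \<and>
      (\<forall>z. (\<forall>t. ((x \<sqinter> t) \<sqinter> (z \<sqinter> t)) \<sqinter> y = (x \<sqinter> t) \<sqinter> (z \<sqinter> t)) \<longrightarrow>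
         z \<sqinter> (x \<star> y) = z)" for x y
    unfolding is_greatest_in_def cone_subset_iff[OF assms(2)]
      meet_eq_left_iff[OF assms(2), of _ "x \<star> y"]
    by simp
  show ?thesis
    unfolding relatively_pseudocomplemented_def top greatest by blast
qed

end
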